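(* Let $(X,d_X)$ and $(Y,d_Y)$ be pointed metric spaces with basepoints $e_X$ and $e_Y$, and let $\phi\colon Y\to X$ be a Lipschitz map with $\phi(e_Y)=e_X$. Assume that $\phi$ is nonexpansive and satisfies the following property: for every $(x,y)\in\widetilde{X}$, there exists a sequence $\{(x_n,y_n)\}_{n\in\mathbb{N}}$ in $\widetilde{Y}$ such that $\phi(x_n)\to x$, $\phi(y_n)\to y$ and $$\frac{d_X(\phi(x_n),\phi(y_n))}{d_Y(x_n,y_n)}\to 1 \quad (n\to\infty).$$ Then the composition operator $C_\phi\colon \mathrm{Lip}_0(X)\to \mathrm{Lip}_0(Y)$, $C_\phi f=f\circ\phi$, is an isometry.
   Context: A pointed metric space is a metric space $(X,d)$ with a designated basepoint $e_X\in X$. For a metric space $X$, $\widetilde{X}=\{(x,y)\in X\times X\colon x\neq y\}$. $\mathrm{Lip}_0(X)$ is the real Banach space of all Lipschitz functions $f\colon X\to\mathbb{R}$ with $f(e_X)=0$, with the norm $\mathrm{Lip}(f)=\sup\{|f(x)-f(y)|/d(x,y)\colon (x,y)\in\widetilde{X}\}$ (the supremum being $0$ if $\widetilde{X}=\emptyset$). Metric spaces are not assumed complete. A basepoint-preserving Lipschitz map $\phi\colon Y\to X$ induces the bounded linear operator $C_\phi\colon\mathrm{Lip}_0(X)\to\mathrm{Lip}_0(Y)$, $C_\phi f=f\circ\phi$. Isometry (not necessarily surjective) means $\mathrm{Lip}(f\circ\phi)=\mathrm{Lip}(f)$ for all $f\in\mathrm{Lip}_0(X)$. The map $\phi$ is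 nonexpansive if $d_X(\phi(u),\phi(v))\leq d_Y(u,v)$ for all $u,v\in Y$. *)

theory Defs
  imports "HOL-Analysis.Analysis"
begin

text \<open>A pointed metric space is rendered as a type of class \<open>metric_space\<close> (not assumed
  complete) together with an explicit basepoint \<open>e\<close>.\<close>

definition off_diag :: "('a \<times> 'a) set" where
  "off_diag = {(x, y). x \<noteq> y}"

definition Lip0 :: "'a::metric_space \<Rightarrow> ('a \<Rightarrow> real) set" where
  "Lip0 e = {f. (\<exists>C. C-lipschitz_on UNIV f) \<and> f e = 0}"

text \<open>The case split is needed because the supremum of the empty set of reals is unspecified.
  The value is meaningful for Lipschitz \<open>f\<close> only; see \<open>bdd_above_Lip\<close>.\<close>

definition Lip :: "('a::metric_space \<Rightarrow> real) \<Rightarrow> real" where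
  "Lip f = (if (off_diag :: ('a \<times> 'a) set) = {} then 0
            else (SUP (x, y)\<in>off_diag. \<bar>f x - f y\<bar> / dist x y))"

definition comp_op :: "('b \<Rightarrow> 'a) \<Rightarrow> ('a \<Rightarrow> real) \<Rightarrow> ('b \<Rightarrow> real)" where
  "comp_op \<phi> f = f \<circ> \<phi>"

text \<open>Norm preservation; surjectivity is not required. It expresses isometry for linear
  operators, such as \<open>comp_op \<phi>\<close>.\<close>

definition Lip0_isometry ::
  "'a::metric_space \<Rightarrow> 'b::metric_space \<Rightarrow> (('a \<Rightarrow> real) \<Rightarrow> ('b \<Rightarrow> real)) \<Rightarrow> bool" where
  "Lip0_isometry eX eY T \<longleftrightarrow>
     T \<in> Lip0 eX \<rightarrow> Lip0 eY \<and> (\<forall>f\<in>Lip0 eX. Lip (T f) = Lip f)"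

definition nonexpansive :: "('b::metric_space \<Rightarrow> 'a::metric_space) \<Rightarrow> bool" where
  "nonexpansive \<phi> \<longleftrightarrow> (\<forall>u v. dist (\<phi> u) (\<phi> v) \<le> dist u v)"

lemma bdd_above_Lip:
  assumes "C-lipschitz_on UNIV (f :: 'a::metric_space \<Rightarrow> real)"
  shows "bdd_above ((\<lambda>(x, y). \<bar>f x - f y\<bar> / dist x y) ` off_diag)"
proof (rule bdd_aboveI2[where M = C])
  fix p :: "'a \<times> 'a"
  assume "p \<in> off_diag"
  then show "(case p of (x, y) \<Rightarrow> \<bar>f x - f y\<bar> / dist x y) \<le> C"
    using lipschitz_onD[OF assms, of "fst p" "snd p"]
    by (auto simp: off_diag_def dist_real_def divide_le_eq split: prod.splits)
qed

end

theory Submission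
  imports Defs
begin

text \<open>Composing with a nonexpansive map cannot increase a Lipschitz constant, so
  \<open>Lip (f \<circ> \<phi>) \<le> Lip f\<close>. For the converse let \<open>L = Lip (f \<circ> \<phi>)\<close>, let \<open>x \<noteq> y\<close>, and take
  sequences \<open>x\<^sub>n\<close>, \<open>y\<^sub>n\<close> as in the hypothesis. Multiplying
  \<open>\<bar>f (\<phi> x\<^sub>n) - f (\<phi> y\<^sub>n)\<bar> \<le> L d(x\<^sub>n, y\<^sub>n)\<close> by the ratio
  \<open>r\<^sub>n = d(\<phi> x\<^sub>n, \<phi> y\<^sub>n) / d(x\<^sub>n, y\<^sub>n)\<close> gives
  \<open>\<bar>f (\<phi> x\<^sub>n) - f (\<phi> y\<^sub>n)\<bar> r\<^sub>n \<le> L d(\<phi> x\<^sub>n, \<phi> y\<^sub>n)\<close>, where distances in the domain of \<open>\<phi>\<close>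
  no longer appear except in \<open>r\<^sub>n\<close>. As \<open>r\<^sub>n \<rightarrow> 1\<close> and \<open>f\<close> is continuous, the limit is
  \<open>\<bar>f x - f y\<bar> \<le> L d(x, y)\<close>, and hence \<open>Lip f \<le> L\<close>.

  Both halves use \<open>Lip f\<close> only as the least Lipschitz constant of \<open>f\<close>, as expressed by
  \<open>abs_diff_le_Lip\<close> and \<open>Lip_le\<close>; these also absorb the one-point spaces.\<close>

lemma abs_diff_le_Lip:
  fixes f :: "'a::metric_space \<Rightarrow> real"
  assumes "C-lipschitz_on UNIV f"
  shows "\<bar>f x - f y\<bar> \<le> Lip f * dist x y"
proof (cases "x = y")
  case False
  then have mem: "(x, y) \<in> off_diag"
    by (simp add: off_diag_def)
  have "\<bar>f x - f y\<bar> / dist x y \<le> Lip f"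
    using cSUP_upper[OF mem bdd_above_Lip[OF assms]] mem by (auto simp: Lip_def)
  with False show ?thesis
    by (simp add: divide_le_eq)
qed simp

lemma Lip_le:
  fixes f :: "'a::metric_space \<Rightarrow> real"
  assumes "0 \<le> M" and "\<And>x y. x \<noteq> y \<Longrightarrow> \<bar>f x - f y\<bar> \<le> M * dist x y"
  shows "Lip f \<le> M"
proof (cases "(off_diag :: ('a \<times> 'a) set) = {}")
  case True
  with assms(1) show ?thesis
    by (simp add: Lip_def)
next
  case False
  then have "(SUP (x, y)\<in>off_diag. \<bar>f x - f y\<bar> / dist x y) \<le> M"
    by (rule cSUP_least) (auto simp: off_diag_def divide_le_eq assms(2))
  with False show ?thesis
    by (simp add: Lip_def)
qed

lemma Lip_nonneg:
  fixes f :: "'a::metric_space \<Rightarrow> real"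
  assumes "C-lipschitz_on UNIV f"
  shows "0 \<le> Lip f"
proof (cases "(off_diag :: ('a \<times> 'a) set) = {}")
  case True
  then show ?thesis
    by (simp add: Lip_def)
next
  case False
  then obtain x y :: 'a where "x \<noteq> y"
    by (auto simp: off_diag_def)
  moreover have "0 \<le> Lip f * dist x y"
    using abs_diff_le_Lip[OF assms, of x y] by linarith
  ultimately show ?thesis
    by (simp add: zero_le_mult_iff)
qed

lemma Lip_comp_nonexpansive_le:
  fixes f :: "'a::metric_space \<Rightarrow> real" and \<phi> :: "'b::metric_space \<Rightarrow> 'a"
  assumes f: "C-lipschitz_on UNIV f" and "nonexpansive \<phi>"
  shows "Lip (f \<circ> \<phi>) \<le> Lip f"
proof (rule Lip_le)
  show "0 \<le> Lip f"
    by (rule Lip_nonneg[OF f])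
next
  fix u v :: 'b
  have "\<bar>f (\<phi> u) - f (\<phi> v)\<bar> \<le> Lip f * dist (\<phi> u) (\<phi> v)"
    by (rule abs_diff_le_Lip[OF f])
  also have "\<dots> \<le> Lip f * dist u v"
    using assms(2) Lip_nonneg[OF f] by (auto simp: nonexpansive_def intro: mult_left_mono)
  finally show "\<bar>(f \<circ> \<phi>) u - (f \<circ> \<phi>) v\<bar> \<le> Lip f * dist u v"
    by simp
qed

text \<open>This is where the sequences enter: \<open>\<phi>\<close> need not reach \<open>x\<close> or \<open>y\<close>, so the bound on
  \<open>f \<circ> \<phi>\<close> is carried from the range of \<open>\<phi>\<close> to its closure by continuity of \<open>f\<close>. Weighting
  by the ratio, instead of dividing by \<open>dist (xs n) (ys n)\<close>, avoids having to find the limit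
  of \<open>dist (xs n) (ys n)\<close>.\<close>

lemma abs_diff_le_Lip_comp_limit:
  fixes f :: "'a::metric_space \<Rightarrow> real" and \<phi> :: "'b::metric_space \<Rightarrow> 'a"
  assumes f: "continuous_on UNIV f" and comp: "C-lipschitz_on UNIV (f \<circ> \<phi>)"
    and x: "(\<lambda>n. \<phi> (xs n)) \<longlonglongrightarrow> x" and y: "(\<lambda>n. \<phi> (ys n)) \<longlonglongrightarrow> y"
    and ratio: "(\<lambda>n. dist (\<phi> (xs n)) (\<phi> (ys n)) / dist (xs n) (ys n)) \<longlonglongrightarrow> 1"
  shows "\<bar>f x - f y\<bar> \<le> Lip (f \<circ> \<phi>) * dist x y"
proof -
  let ?L = "Lip (f \<circ> \<phi>)"
  let ?r = "\<lambda>n. dist (\<phi> (xs n)) (\<phi> (ys n)) / dist (xs n) (ys n)"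
  have f_lim: "(\<lambda>n. f (z n)) \<longlonglongrightarrow> f l" if "z \<longlonglongrightarrow> l" for z l
    using continuous_on_tendsto_compose[OF f that] by simp
  have lhs: "(\<lambda>n. \<bar>f (\<phi> (xs n)) - f (\<phi> (ys n))\<bar> * ?r n) \<longlonglongrightarrow> \<bar>f x - f y\<bar> * 1"
    by (intro tendsto_intros f_lim x y ratio)
  have rhs: "(\<lambda>n. ?L * dist (\<phi> (xs n)) (\<phi> (ys n))) \<longlonglongrightarrow> ?L * dist x y"
    by (intro tendsto_intros x y)
  have "\<bar>f (\<phi> (xs n)) - f (\<phi> (ys n))\<bar> * ?r n \<le> ?L * dist (\<phi> (xs n)) (\<phi> (ys n))" for n
  proof -
    have "\<bar>f (\<phi> (xs n)) - f (\<phi> (ys n))\<bar> * ?r n \<le> (?L * dist (xs n) (ys n)) * ?r n"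
      using abs_diff_le_Lip[OF comp, of "xs n" "ys n"] by (intro mult_right_mono) auto
    \<comment> \<open>If \<open>xs n = ys n\<close>, both sides are \<open>0\<close>.\<close>
    also have "\<dots> = ?L * dist (\<phi> (xs n)) (\<phi> (ys n))"
      by (cases "xs n = ys n") auto
    finally show ?thesis .
  qed
  then show ?thesis
    using LIMSEQ_le[OF lhs rhs] by auto
qed

theorem theorem2p1:
  fixes eX :: "'a::metric_space" and eY :: "'b::metric_space" and \<phi> :: "'b \<Rightarrow> 'a"
  assumes "\<exists>C. C-lipschitz_on UNIV \<phi>"
    and "\<phi> eY = eX"
    and "nonexpansive \<phi>"
    and "\<And>x y. (x, y) \<in> off_diag \<Longrightarrow>
      \<exists>xs ys :: nat \<Rightarrow> 'b.
        (\<forall>n. (xs n, ys n) \<in> off_diag) \<and>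
        (\<lambda>n. \<phi> (xs n)) \<longlonglongrightarrow> x \<and>
        (\<lambda>n. \<phi> (ys n)) \<longlonglongrightarrow> y \<and>
        (\<lambda>n. dist (\<phi> (xs n)) (\<phi> (ys n)) / dist (xs n) (ys n)) \<longlonglongrightarrow> 1"
  shows "Lip0_isometry eX eY (comp_op \<phi>)"
proof -
  obtain D where \<phi>: "D-lipschitz_on UNIV \<phi>"
    using assms(1) by blast
  have "comp_op \<phi> f \<in> Lip0 eY \<and> Lip (comp_op \<phi> f) = Lip f" if mem: "f \<in> Lip0 eX" for f
  proof -
    obtain C where f: "C-lipschitz_on UNIV f" and zero: "f eX = 0"
      using mem by (auto simp: Lip0_def)
    have comp: "(C * D)-lipschitz_on UNIV (f \<circ> \<phi>)"
      using lipschitz_on_compose[OF \<phi>] lipschitz_on_subset[OF f] by blast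
    have "Lip f \<le> Lip (f \<circ> \<phi>)"
    proof (rule Lip_le[OF Lip_nonneg[OF comp]])
      fix x y :: 'a
      assume "x \<noteq> y"
      then obtain xs ys :: "nat \<Rightarrow> 'b"
        where "(\<lambda>n. \<phi> (xs n)) \<longlonglongrightarrow> x" "(\<lambda>n. \<phi> (ys n)) \<longlonglongrightarrow> y"
          "(\<lambda>n. dist (\<phi> (xs n)) (\<phi> (ys n)) / dist (xs n) (ys n)) \<longlonglongrightarrow> 1"
        using assms(4)[of x y] by (auto simp: off_diag_def)
      then show "\<bar>f x - f y\<bar> \<le> Lip (f \<circ> \<phi>) * dist x y"
        by (rule abs_diff_le_Lip_comp_limit[OF lipschitz_on_continuous_on[OF f] comp])
    qed
    with Lip_comp_nonexpansive_le[OF f assms(3)] have "Lip (f \<circ> \<phi>) = Lip f"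
      by simp
    with comp zero assms(2) show ?thesis
      by (auto simp: comp_op_def Lip0_def)
  qed
  then show ?thesis
    by (auto simp: Lip0_isometry_def)
qed

end
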